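(* The competitive ratio of $\textsc{Bins}^*$ for $\mathcal{D}_{\infty}^{<}(m / \log m)$ is $O(\log m)$; that is, there is an absolute constant $c$ such that $p_{\textsc{Bins}^*}(D)\le c\log m\cdot p_*(D)$ for every $D\in \mathcal{D}_{\infty}^{<}(m / \log m)$.
   Context: Fix $m\in\mathbb N$ (large enough that the construction below is defined) and the universe of IDs $[m]=\{1,\dots,m\}$; $\log$ is base 2. An ID-generation algorithm $\mathcal A$ is a probability distribution over orderings of IDs of $[m]$: an instance draws an ordering and answers its $t$-th request with the $t$-th entry. A demand profile $D=(d_1,\dots,d_n)\in[m]^n$ means $n$ instances with independent randomness, instance $i$ receiving $d_i$ requests one at a time without knowing $d_i$ in advance. A collision occurs if the sets of IDs output by the instances are not pairwise disjoint; $p_{\mathcal A}(D)$ is the collision probability and $p_*(D)=\min_{\mathcal A'}p_{\mathcal A'}(D)$ over all algorithms. $\mathcal D_\infty^{<}(h)=\bigcup_{i\ge2}\{D\in[m]^i: \max_j d_j<h\}$. Algorithm $\textsc{Bins}^*$: let $C=\lceil \log m-\log\log m\rceil$; partition part of $[m]$ into $C$ disjoint chunks of $2^{C-1}$ IDs each (possible since $C2^{C-1}\le m$), and partition the $i$-th chunk ($i\in[C]$) into $2^{C-i}$ bins of $2^{i-1}$ IDs each. An instance picks a uniformly random bin of chunk 1 (size 1), then a uniformly random bin of chunk 2 (size 2), then of chunk 3 (size 4), and so on, returning all IDs of a bin in increasing order before moving on to the next bin. *)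

theory Defs
  imports "HOL-Probability.Probability" "HOL-Combinatorics.Multiset_Permutations"
begin

definition id_algs :: "nat \<Rightarrow> nat list pmf set" where
  "id_algs m = {A. set_pmf A \<subseteq> permutations_of_set {1..m}}"

definition collision :: "nat list \<Rightarrow> (nat \<Rightarrow> nat list) \<Rightarrow> bool" where
  "collision D \<omega> \<longleftrightarrow> \<not> disjoint_family_on (\<lambda>i. set (take (D ! i) (\<omega> i))) {..<length D}"

definition p_coll :: "nat list pmf \<Rightarrow> nat list \<Rightarrow> real" where
  "p_coll A D = measure_pmf.prob (Pi_pmf {..<length D} [] (\<lambda>_. A)) {\<omega>. collision D \<omega>}"

text \<open>The minimum over all algorithms is attained (a continuous function on the compact set of
  distributions on a finite set), so the infimum below is a minimum.\<close>

definition p_star :: "nat \<Rightarrow> nat list \<Rightarrow> real" where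
  "p_star m D = (INF A\<in>id_algs m. p_coll A D)"

definition profiles_less :: "nat \<Rightarrow> real \<Rightarrow> nat list set" where
  "profiles_less m h = (\<Union>n\<in>{2..}. {D. length D = n \<and> set D \<subseteq> {1..m} \<and> real (Max (set D)) < h})"

definition num_chunks :: "nat \<Rightarrow> nat" where
  "num_chunks m = nat \<lceil>log 2 (real m) - log 2 (log 2 (real m))\<rceil>"

text \<open>The chunks \<open>K i\<close> and the sets \<open>B i\<close> of bins of chunk \<open>i\<close> may be laid out inside \<open>[m]\<close> in any
  way that respects the prescribed sizes.\<close>

definition bins_layout :: "nat \<Rightarrow> (nat \<Rightarrow> nat set) \<Rightarrow> (nat \<Rightarrow> nat set set) \<Rightarrow> bool" where
  "bins_layout m K B \<longleftrightarrow>
     (let C = num_chunks m in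
        disjoint_family_on K {1..C} \<and>
        (\<forall>i\<in>{1..C}. K i \<subseteq> {1..m} \<and> card (K i) = 2 ^ (C - 1) \<and>
           partition_on (K i) (B i) \<and> card (B i) = 2 ^ (C - i) \<and>
           (\<forall>b\<in>B i. card b = 2 ^ (i - 1))))"

text \<open>The bins supply \<open>2 ^ C - 1\<close> IDs, where \<open>C = num_chunks m\<close>. To obtain an ordering of all of
  \<open>[m]\<close>, the remaining IDs are appended in increasing order; instances that receive fewer than
  \<open>m / log 2 m \<le> 2 ^ C\<close> requests never reach them.\<close>

definition bins_star :: "nat \<Rightarrow> (nat \<Rightarrow> nat set set) \<Rightarrow> nat list pmf" where
  "bins_star m B =
     (let C = num_chunks m in
        map_pmf (\<lambda>b. let xs = concat (map (\<lambda>i. sorted_list_of_set (b i)) [1..<Suc C])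
                     in xs @ sorted_list_of_set ({1..m} - set xs))
          (Pi_pmf {1..C} {} (\<lambda>i. pmf_of_set (B i))))"

lemma num_chunks_le:
  assumes "m \<ge> 2"
  shows "num_chunks m * 2 ^ (num_chunks m - 1) \<le> m"
proof -
  define L where "L = log 2 (real m)"
  define C where "C = num_chunks m"
  have L1: "L \<ge> 1" unfolding L_def using assms by (simp add: le_log_iff)
  have Cdef: "C = nat \<lceil>L - log 2 L\<rceil>" by (simp add: C_def num_chunks_def L_def)
  show ?thesis
  proof (cases "C \<le> 1")
    case True
    then have "C = 0 \<or> C = 1" by auto
    then show ?thesis using assms by (auto simp flip: C_def)
  next
    case False
    then have C: "real C < L - log 2 L + 1" unfolding Cdef by linarith
    have "2 powr (real C - 1) \<le> 2 powr (L - log 2 L)" using C by simp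
    also have "\<dots> = m / L" using L1 assms by (simp add: powr_diff L_def)
    finally have p: "2 ^ (C - 1) \<le> m / L"
      using False by (simp add: powr_diff powr_realpow flip: of_nat_diff) (simp add: power_diff)
    have m4: "L \<ge> 2"
    proof (rule ccontr)
      assume "\<not> L \<ge> 2"
      then have "m < 4" using assms unfolding L_def by (auto simp: le_log_iff not_le)
      then have "m = 2 \<or> m = 3" using assms by auto
      then have "L - log 2 L \<le> 1"
      proof
        assume "m = 2" then show ?thesis by (simp add: L_def)
      next
        assume m: "m = 3"
        have "3 = log 2 (8::real)" using log_pow_cancel[of 2 3] by simp
        also have "\<dots> \<le> log 2 (9::real)" by simp
        also have "\<dots> = 2 * L" using log_nat_power[of 3 2 2] by (simp add: L_def m)
        finally have "3 / 2 \<le> L" by simp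
        then have "log 2 (3/2) \<le> log 2 L" by simp
        then show ?thesis by (simp add: L_def m log_divide)
      qed
      then show False using False unfolding Cdef by linarith
    qed
    then have "log 2 L \<ge> 1" by (simp add: le_log_iff)
    then have "real C \<le> L" using C by simp
    then have "real C * 2 ^ (C - 1) \<le> L * (m / L)" using p L1 by (intro mult_mono) auto
    also have "\<dots> = m" using L1 by simp
    finally have "real (C * 2 ^ (C - 1)) \<le> real m" by simp
    then show ?thesis unfolding C_def of_nat_le_iff .
  qed
qed

lemma bins_layout_exists:
  assumes "m \<ge> 2"
  shows "\<exists>K B. bins_layout m K B"
proof -
  define C where "C = num_chunks m"
  define K where "K = (\<lambda>i. {(i-1) * 2^(C-1) <.. i * (2::nat)^(C-1)})"
  define b where "b = (\<lambda>i j. {(i-1) * 2^(C-1) + j * 2^(i-1) <.. (i-1) * 2^(C-1) + Suc j * (2::nat)^(i-1)})"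
  define B where "B = (\<lambda>i. b i ` {..<2^(C-i)})"
  have disj': "{e + a * n <.. e + Suc a * n} \<inter> {e + c * n <.. e + Suc c * n} = {}" if "a \<noteq> c" for a c n e :: nat
  proof -
    have "Suc a * n \<le> c * n \<or> Suc c * n \<le> a * n"
      using that by (cases a c rule: linorder_cases) (auto simp del: mult_Suc intro!: mult_right_mono)
    then show ?thesis by auto
  qed
  have Ci: "K i \<subseteq> {1..m} \<and> card (K i) = 2 ^ (C - 1) \<and>
           partition_on (K i) (B i) \<and> card (B i) = 2 ^ (C - i) \<and>
           (\<forall>b\<in>B i. card b = 2 ^ (i - 1))" if i: "i \<in> {1..C}" for i
  proof -
    obtain k where k: "i = Suc k" using i by (cases i) auto
    have pw: "(2::nat)^(C-1) = 2^(C-i) * 2^(i-1)"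
      using i by (simp flip: power_add)
    have "i * 2^(C-1) \<le> C * (2::nat)^(C-1)" using i by simp
    also have "\<dots> \<le> m" using num_chunks_le[OF assms] by (simp add: C_def)
    finally have sub: "K i \<subseteq> {1..m}" by (auto simp: K_def)
    have cardK: "card (K i) = 2 ^ (C - 1)" by (simp add: K_def k)
    have cardb: "card (b i j) = 2 ^ (i - 1)" for j by (simp add: b_def)
    then have bne: "b i j \<noteq> {}" for j by (metis card.empty power_not_zero zero_neq_numeral)
    have bd: "b i j \<inter> b i l = {}" if "j \<noteq> l" for j l
      unfolding b_def by (rule disj'[OF that])
    have inj: "inj_on (b i) A" for A
      using bd bne by (metis inf.idem inj_onI)
    have fin: "finite (b i j)" for j by (simp add: b_def)
    have bK: "b i j \<subseteq> K i" if "j < 2^(C-i)" for j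
    proof -
      have "Suc j * (2::nat)^(i-1) \<le> 2^(C-i) * 2^(i-1)"
        using that by (intro mult_right_mono) auto
      then have "(i-1) * 2^(C-1) + Suc j * (2::nat)^(i-1) \<le> i * 2^(C-1)"
        unfolding pw[symmetric] by (simp add: k)
      then show ?thesis by (auto simp: b_def K_def simp del: mult_Suc)
    qed
    have "card (\<Union>(B i)) = (\<Sum>j<2^(C-i). card (b i j))"
      unfolding B_def using bd fin by (intro card_UN_disjoint) auto
    also have "\<dots> = card (K i)" using cardb cardK pw by simp
    finally have "\<Union>(B i) = K i"
      using bK by (intro card_subset_eq) (auto simp: B_def K_def)
    moreover have "disjoint (B i)"
      unfolding disjoint_def B_def using bd by (metis imageE)
    moreover have "{} \<notin> B i" unfolding B_def using bne by (metis imageE)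
    ultimately have "partition_on (K i) (B i)" by (simp add: partition_on_def)
    then show ?thesis using sub cardK cardb inj by (auto simp: B_def card_image)
  qed
  have "disjoint_family_on K {1..C}"
    unfolding disjoint_family_on_def
  proof (intro ballI impI)
    fix i j assume *: "i \<in> {1..C}" "j \<in> {1..C}" "i \<noteq> j"
    then obtain i' j' where "i = Suc i'" "j = Suc j'" by (metis atLeastAtMost_iff not_one_le_zero not0_implies_Suc)
    with * show "K i \<inter> K j = {}"
      using disj'[of i' j' 0 "2^(C-1)"] by (simp add: K_def)
  qed
  with Ci show ?thesis unfolding bins_layout_def C_def[symmetric] Let_def by blast
qed

lemma bins_star_in_id_algs:
  assumes "bins_layout m K B"
  shows "bins_star m B \<in> id_algs m"
proof -
  define C where "C = num_chunks m"
  note L = assms[unfolded bins_layout_def Let_def, folded C_def]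
  have main: "concat (map (\<lambda>i. sorted_list_of_set (b i)) [1..<Suc C]) @
      sorted_list_of_set ({1..m} - set (concat (map (\<lambda>i. sorted_list_of_set (b i)) [1..<Suc C])))
      \<in> permutations_of_set {1..m}" (is "?xs @ _ \<in> _")
    if b: "b \<in> set_pmf (Pi_pmf {1..C} {} (\<lambda>i. pmf_of_set (B i)))" for b
  proof -
    have bi: "b i \<in> B i" if "i \<in> {1..C}" for i
    proof -
      have "card (B i) > 0" using L that by simp
      then have "finite (B i)" "B i \<noteq> {}" by (auto simp: card_gt_0_iff)
      moreover have "b i \<in> set_pmf (pmf_of_set (B i))"
        using b that by (auto simp: set_Pi_pmf PiE_dflt_def)
      ultimately show ?thesis by simp
    qed
    have sub: "b i \<subseteq> K i" "b i \<subseteq> {1..m}" "finite (b i)" if "i \<in> {1..C}" for i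
    proof -
      have "\<Union>(B i) = K i" "K i \<subseteq> {1..m}" using L that by (auto simp: partition_on_def)
      then show "b i \<subseteq> K i" "b i \<subseteq> {1..m}" using bi[OF that] by blast+
      then show "finite (b i)" using finite_subset by blast
    qed
    have dist: "distinct (concat (map (\<lambda>i. sorted_list_of_set (b i)) [1..<Suc n]))"
      if "n \<le> C" for n
      using that
    proof (induction n)
      case (Suc n)
      have "b i \<inter> b (Suc n) = {}" if "i \<in> {1..n}" for i
      proof -
        have "K i \<inter> K (Suc n) = {}"
          using L that Suc.prems by (auto simp: disjoint_family_on_def)
        then show ?thesis using sub(1)[of i] sub(1)[of "Suc n"] that Suc.prems by fastforce
      qed
      moreover have "finite (b i)" if "i \<in> {1..Suc n}" for i using sub(3) that Suc.prems by simp
      ultimately show ?case using Suc by (fastforce simp: set_sorted_list_of_set)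
    qed simp
    have "set ?xs \<subseteq> {1..m}" using sub by fastforce
    then show ?thesis
      using dist[of C] by (auto simp: permutations_of_set_def simp del: upt_Suc)
  qed
  then show ?thesis
    unfolding id_algs_def bins_star_def Let_def C_def[symmetric] mem_Collect_eq set_map_pmf
    by (rule image_subsetI)
qed

end

theory Submission
  imports Defs
begin

text \<open>Write \<open>T = (\<Sum>i<j. min d\<^sub>i d\<^sub>j)\<close>. For the bins algorithm a union bound over
  pairs of instances and over chunks gives \<open>p(D) \<le> 4 T / 2\<^sup>C \<le> 4 T log m / m\<close>, since the bins
  used by the smaller instance of a pair have total size comparable to its demand.

  Conversely, every algorithm collides with probability at least \<open>min 1 (T / (32 m)) / 2\<close>. An ID
  is heavy for the demand \<open>d\<close> if it is among the first \<open>d\<close> outputs with probability at least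
  \<open>d / (2 m)\<close>; on average at least half of the first \<open>d\<close> outputs are heavy, and an instance with
  demand \<open>d\<close> hits a fixed set \<open>U\<close> with probability at least \<open>|U \<inter> heavy| / (2 m)\<close>. Split the
  instances along a cut carrying half of \<open>T\<close> and condition on one side: the probability of no
  collision is then at most a product of expectations of \<open>exp (- X)\<close> with \<open>0 \<le> X \<le> 1\<close>, which
  multiply to at most \<open>exp (- T / (32 m))\<close>. The bound \<open>X \<le> 1\<close> needs \<open>(\<Sum>i. d\<^sub>i) \<le> m\<close>; otherwise a
  collision is certain.\<close>

definition pair_load :: "nat list \<Rightarrow> real" where
  "pair_load D = (\<Sum>j<length D. \<Sum>i<j. real (min (D ! i) (D ! j)))"

section \<open>Product distributions\<close>

text \<open>Once coordinate \<open>i\<close> is split off, \<open>j\<close> is still a coordinate of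
  the remaining independent product, so their joint law is the pair distribution.\<close>

lemma prob_Pi_pmf_pair:
  assumes "finite I" "i \<in> I" "j \<in> I" "i \<noteq> j"
  shows "measure_pmf.prob (Pi_pmf I dflt p) {\<omega>. R (\<omega> i) (\<omega> j)} =
    measure_pmf.prob (pair_pmf (p i) (p j)) {(x, y). R x y}"
proof -
  have eq: "Pi_pmf I dflt p = map_pmf (\<lambda>(y, f). f(i := y)) (pair_pmf (p i) (Pi_pmf (I - {i}) dflt p))"
    using Pi_pmf_insert[of "I - {i}" i dflt p] assms by (simp add: insert_absorb)
  have "map_pmf (\<lambda>\<omega>. (\<omega> i, \<omega> j)) (Pi_pmf I dflt p) =
      map_pmf (\<lambda>(y, f). (id y, f j)) (pair_pmf (p i) (Pi_pmf (I - {i}) dflt p))"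
    unfolding eq map_pmf_comp using assms(4) by (intro map_pmf_cong) auto
  also have "\<dots> = pair_pmf (map_pmf id (p i)) (map_pmf (\<lambda>f. f j) (Pi_pmf (I - {i}) dflt p))"
    by (rule map_pair)
  also have "\<dots> = pair_pmf (p i) (p j)"
    using assms by (subst Pi_pmf_component) (auto simp: map_pmf_id)
  finally have "measure_pmf.prob (pair_pmf (p i) (p j)) {(x, y). R x y} =
      measure_pmf.prob (map_pmf (\<lambda>\<omega>. (\<omega> i, \<omega> j)) (Pi_pmf I dflt p)) {(x, y). R x y}"
    by simp
  then show ?thesis by (simp add: vimage_def)
qed

text \<open>Tonelli: the probability is the mean over \<open>a\<close> of the probability of the
  section of \<open>S\<close> at \<open>a\<close>.\<close>

lemma prob_pair_pmf_le:
  fixes g :: "'a \<Rightarrow> real"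
  assumes int: "integrable (measure_pmf M) g" and nonneg: "\<And>a. g a \<ge> 0"
    and le: "\<And>a. a \<in> set_pmf M \<Longrightarrow> measure_pmf.prob N {b. (a, b) \<in> S} \<le> g a"
  shows "measure_pmf.prob (pair_pmf M N) S \<le> measure_pmf.expectation M g"
proof -
  have "emeasure (pair_pmf M N) S = (\<integral>\<^sup>+a. \<integral>\<^sup>+b. indicator S (a, b) \<partial>N \<partial>M)"
    by (subst nn_integral_pair_pmf'[symmetric]) simp
  also have "\<dots> = (\<integral>\<^sup>+a. emeasure N {b. (a, b) \<in> S} \<partial>M)"
  proof (rule nn_integral_cong)
    fix a
    have "(\<lambda>b. indicator S (a, b)) = (indicator {b. (a, b) \<in> S} :: _ \<Rightarrow> ennreal)"
      by (auto simp: indicator_def)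
    then show "(\<integral>\<^sup>+b. indicator S (a, b) \<partial>N) = emeasure N {b. (a, b) \<in> S}" by simp
  qed
  also have "\<dots> \<le> (\<integral>\<^sup>+a. ennreal (g a) \<partial>M)"
    using le by (intro nn_integral_mono_AE)
      (auto simp: AE_measure_pmf_iff measure_pmf.emeasure_eq_measure intro!: ennreal_leI)
  also have "\<dots> = ennreal (measure_pmf.expectation M g)"
    using int nonneg by (intro nn_integral_eq_integral) auto
  finally show ?thesis
    by (simp add: measure_pmf.emeasure_eq_measure integral_nonneg_AE nonneg)
qed

text \<open>The pair is uniform on \<open>S \<times> S\<close>, whose diagonal has
  \<open>card S\<close> elements.\<close>

lemma prob_pair_pmf_of_set_eq:
  assumes "finite S" "S \<noteq> {}"
  shows "measure_pmf.prob (pair_pmf (pmf_of_set S) (pmf_of_set S)) {(x, y). x = y} = 1 / card S"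
proof -
  have "pair_pmf (pmf_of_set S) (pmf_of_set S) = pmf_of_set (S \<times> S)"
    using assms by (intro pmf_eqI) (auto simp: pmf_pair pmf_of_set[OF assms(2,1)] pmf_of_set
      indicator_def card_cartesian_product split: if_splits)
  then have "measure_pmf.prob (pair_pmf (pmf_of_set S) (pmf_of_set S)) {(x, y). x = y} =
      measure_pmf.prob (pmf_of_set (S \<times> S)) {(x, y). x = y}" by simp
  also have "\<dots> = card (S \<times> S \<inter> {(x, y). x = y}) / card (S \<times> S)"
    using assms by (intro measure_pmf_of_set) auto
  also have "S \<times> S \<inter> {(x, y). x = y} = (\<lambda>x. (x, x)) ` S" by auto
  also have "card \<dots> = card S" by (simp add: card_image inj_on_def)
  finally show ?thesis using assms by (simp add: card_cartesian_product)
qed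

section \<open>An exponential inequality and a greedy cut\<close>

text \<open>A converse to \<open>1 - x \<le> exp (- x)\<close> on the unit interval. It yields upper
  bounds on the mean of an exponential, where Jensen's inequality points the wrong way.\<close>

lemma exp_minus_le_linear:
  fixes x :: real
  assumes "0 \<le> x" "x \<le> 1"
  shows "exp (-x) \<le> 1 - x / 2"
proof -
  have "x * x \<le> x * 1" using assms by (intro mult_left_mono)
  then have "1 \<le> (1 - x / 2) * (1 + x)" by (simp add: field_simps)
  also have "\<dots> \<le> (1 - x / 2) * exp x"
    using assms by (intro mult_left_mono exp_ge_add_one_self) auto
  finally show ?thesis by (simp add: exp_minus field_simps)
qed

text \<open>The greedy argument for maximum cut: vertex \<open>n\<close> is put on the side opposite
  to the one it has more weight to, so at least half of its weight to the earlier vertices crosses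
  the cut.\<close>

lemma exists_large_cut:
  fixes s :: "nat \<Rightarrow> nat \<Rightarrow> real"
  assumes sym: "\<And>i j. s i j = s j i"
  shows "\<exists>A\<subseteq>{..<n}. (\<Sum>j<n. \<Sum>i<j. s i j) \<le> 2 * (\<Sum>i\<in>A. \<Sum>j\<in>{..<n} - A. s i j)"
proof (induction n)
  case 0
  then show ?case by simp
next
  case (Suc n)
  then obtain A where A: "A \<subseteq> {..<n}"
    and cut: "(\<Sum>j<n. \<Sum>i<j. s i j) \<le> 2 * (\<Sum>i\<in>A. \<Sum>j\<in>{..<n} - A. s i j)" by blast
  have fin: "finite A" using A finite_subset by blast
  have split: "(\<Sum>i<n. s i n) = (\<Sum>i\<in>A. s i n) + (\<Sum>i\<in>{..<n} - A. s i n)"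
    using A by (metis add.commute finite_lessThan sum.subset_diff)
  show ?case
  proof (cases "(\<Sum>i\<in>A. s i n) \<ge> (\<Sum>i\<in>{..<n} - A. s i n)")
    case True
    have "{..<Suc n} - A = insert n ({..<n} - A)" using A by auto
    then have "(\<Sum>i\<in>A. \<Sum>j\<in>{..<Suc n} - A. s i j) =
        (\<Sum>i\<in>A. s i n) + (\<Sum>i\<in>A. \<Sum>j\<in>{..<n} - A. s i j)"
      by (simp add: sum.distrib)
    then show ?thesis using True cut split A
      by (intro exI[of _ A]) (auto simp: less_Suc_eq)
  next
    case False
    have "{..<Suc n} - insert n A = {..<n} - A" "n \<notin> A" using A by auto
    then have "(\<Sum>i\<in>insert n A. \<Sum>j\<in>{..<Suc n} - insert n A. s i j) =
        (\<Sum>i\<in>{..<n} - A. s i n) + (\<Sum>i\<in>A. \<Sum>j\<in>{..<n} - A. s i j)"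
      using fin sym by simp
    then show ?thesis using False cut split A
      by (intro exI[of _ "insert n A"]) (auto simp: less_Suc_eq)
  qed
qed

section \<open>Upper bound for the bins algorithm\<close>

text \<open>The bins of the first \<open>k\<close> chunks supply \<open>2 ^ k - 1\<close> IDs, so a
  demand below \<open>2 ^ k\<close> never goes beyond chunk \<open>k\<close>.\<close>

lemma take_bins_subset:
  fixes b :: "nat \<Rightarrow> nat set"
  assumes card: "\<And>i. i \<in> {1..C} \<Longrightarrow> card (b i) = 2 ^ (i - 1)" and "k \<le> C" "d < 2 ^ k"
  shows "set (take d (concat (map (\<lambda>i. sorted_list_of_set (b i)) [1..<Suc C]) @ ys))
    \<subseteq> (\<Union>i\<in>{1..k}. b i)"
proof -
  \<comment> \<open>The \<open>Suc\<close> makes up for the missing one in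
    \<open>1 + 2 + ... + 2 ^ (n - 1) = 2 ^ n - 1\<close>.\<close>
  have len: "Suc (length (concat (map (\<lambda>i. sorted_list_of_set (b i)) [1..<Suc n]))) = 2 ^ n"
    if "n \<le> C" for n
    using that by (induction n) (auto simp: card)
  have fin: "finite (b i)" if "i \<in> {1..C}" for i
    using card[OF that] by (metis card.infinite power_not_zero zero_neq_numeral)
  have "[1..<Suc C] = [1..<Suc k] @ [Suc k..<Suc C]"
    using assms(2) by (metis Suc_le_mono le_add1 plus_1_eq_Suc upt_add_eq_append le_Suc_ex add_Suc)
  then have "take d (concat (map (\<lambda>i. sorted_list_of_set (b i)) [1..<Suc C]) @ ys) =
      take d (concat (map (\<lambda>i. sorted_list_of_set (b i)) [1..<Suc k]))"
    using len[OF assms(2)] assms(3) by (simp del: upt_Suc)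
  also have "set \<dots> \<subseteq> set (concat (map (\<lambda>i. sorted_list_of_set (b i)) [1..<Suc k]))"
    by (rule set_take_subset)
  also have "\<dots> \<subseteq> (\<Union>i\<in>{1..k}. b i)"
    using fin assms(2) by (fastforce simp del: upt_Suc)
  finally show ?thesis .
qed

text \<open>A common ID forces both instances to have picked the same bin in a chunk opened by the
  smaller one. For chunk \<open>i\<close> this has probability \<open>2 ^ i / 2 ^ C\<close>, and
  these probabilities form a geometric sum.\<close>

lemma bins_star_pair_collision:
  assumes lay: "bins_layout m K B" and d: "1 \<le> d" "d \<le> d'" "d' < 2 ^ num_chunks m"
  shows "measure_pmf.prob (pair_pmf (bins_star m B) (bins_star m B))
      {(x, y). set (take d x) \<inter> set (take d' y) \<noteq> {}} \<le> 4 * d / 2 ^ num_chunks m"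
proof -
  define C where "C = num_chunks m"
  note L = lay[unfolded bins_layout_def Let_def, folded C_def]
  define P where "P = Pi_pmf {1..C} {} (\<lambda>i. pmf_of_set (B i))"
  define F where "F = (\<lambda>b. let xs = concat (map (\<lambda>i. sorted_list_of_set (b i)) [1..<Suc C])
                     in xs @ sorted_list_of_set ({1..m} - set xs))"
  have bs: "bins_star m B = map_pmf F P"
    by (simp add: bins_star_def P_def F_def C_def Let_def)
  have Bfin: "finite (B i)" "B i \<noteq> {}" if "i \<in> {1..C}" for i
  proof -
    have "card (B i) > 0" using L that by simp
    then show "finite (B i)" "B i \<noteq> {}" by (auto simp: card_gt_0_iff)
  qed
  have Bin: "b i \<in> B i" if "b \<in> set_pmf P" "i \<in> {1..C}" for b i
  proof -
    have "b i \<in> set_pmf (pmf_of_set (B i))"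
      using that by (auto simp: P_def set_Pi_pmf PiE_dflt_def)
    then show ?thesis using Bfin[OF that(2)] by simp
  qed
  have sub: "set (take e (F b)) \<subseteq> (\<Union>i\<in>{1..k}. b i)"
    if "b \<in> set_pmf P" "k \<le> C" "e < 2 ^ k" for b e k
    unfolding F_def Let_def using that Bin[OF that(1)] L by (intro take_bins_subset) auto
  \<comment> \<open>Thus \<open>k\<close> is the rounded-down binary logarithm of \<open>d\<close>,
    and the smaller instance stays within chunks \<open>1\<close> to \<open>Suc k\<close>.\<close>
  obtain k where k: "2 ^ k \<le> d" "d < 2 ^ (k + 1)"
    using ex_power_ivl1[of 2 d] d(1) by auto
  have "(2::nat) ^ k < 2 ^ C" using k(1) d unfolding C_def by linarith
  then have kC: "Suc k \<le> C" by simp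
  \<comment> \<open>Chunks are disjoint, and so are the bins of one chunk; a shared ID therefore
    determines both the chunk and the bin.\<close>
  have hit: "\<exists>i\<in>{1..Suc k}. b i = b' i"
    if b: "b \<in> set_pmf P" "b' \<in> set_pmf P" and ne: "set (take d (F b)) \<inter> set (take d' (F b')) \<noteq> {}" for b b'
  proof -
    obtain x where x: "x \<in> set (take d (F b))" "x \<in> set (take d' (F b'))" using ne by blast
    obtain i where i: "i \<in> {1..Suc k}" "x \<in> b i"
      using sub[OF b(1) kC, of d] x(1) k(2) by auto
    obtain j where j: "j \<in> {1..C}" "x \<in> b' j"
      using sub[OF b(2) order_refl, of d'] x(2) d(3) by (auto simp: C_def)
    have iC: "i \<in> {1..C}" using i(1) kC by auto
    have part: "partition_on (K i) (B i)" "partition_on (K j) (B j)" using L iC j(1) by auto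
    have "x \<in> K i" "x \<in> K j"
      using part Bin[OF b(1) iC] Bin[OF b(2) j(1)] i(2) j(2) by (auto simp: partition_on_def)
    then have "i = j" using L iC j(1) disjoint_family_onD[of K "{1..C}" i j] by blast
    then have "b i = b' i"
      using part(1) Bin[OF b(1) iC] Bin[OF b(2) j(1)] i(2) j(2)
      by (auto simp: partition_on_def disjoint_def)
    then show ?thesis using i(1) by blast
  qed
  have same: "measure_pmf.prob (pair_pmf P P) {(b, b'). b i = b' i} = 2 ^ i / 2 ^ C"
    if i: "i \<in> {1..Suc k}" for i
  proof -
    have iC: "i \<in> {1..C}" using i kC by auto
    have "pair_pmf (pmf_of_set (B i)) (pmf_of_set (B i)) = map_pmf (\<lambda>(b, b'). (b i, b' i)) (pair_pmf P P)"
      unfolding map_pair P_def using iC by (simp add: Pi_pmf_component)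
    then have "measure_pmf.prob (pair_pmf P P) {(b, b'). b i = b' i} =
        measure_pmf.prob (pair_pmf (pmf_of_set (B i)) (pmf_of_set (B i))) {(x, y). x = y}"
      by (simp add: vimage_def case_prod_unfold)
    also have "\<dots> = 1 / 2 ^ (C - i)"
      using Bfin[OF iC] L iC by (subst prob_pair_pmf_of_set_eq) auto
    also have "\<dots> = 2 ^ i / 2 ^ C" using iC by (simp add: power_diff)
    finally show ?thesis .
  qed
  have "pair_pmf (bins_star m B) (bins_star m B) = map_pmf (\<lambda>(b, b'). (F b, F b')) (pair_pmf P P)"
    by (simp add: bs map_pair)
  then have "measure_pmf.prob (pair_pmf (bins_star m B) (bins_star m B))
      {(x, y). set (take d x) \<inter> set (take d' y) \<noteq> {}} =
      measure_pmf.prob (pair_pmf P P) {(b, b'). set (take d (F b)) \<inter> set (take d' (F b')) \<noteq> {}}"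
    by (simp add: vimage_def case_prod_unfold)
  also have "\<dots> \<le> measure_pmf.prob (pair_pmf P P) (\<Union>i\<in>{1..Suc k}. {(b, b'). b i = b' i})"
    using hit by (intro measure_pmf.finite_measure_mono_AE) (auto simp: AE_measure_pmf_iff)
  also have "\<dots> \<le> (\<Sum>i\<in>{1..Suc k}. measure_pmf.prob (pair_pmf P P) {(b, b'). b i = b' i})"
    by (intro measure_UNION_le) auto
  also have "\<dots> = (\<Sum>i\<in>{1..Suc k}. 2 ^ i) / 2 ^ C"
    unfolding sum_divide_distrib by (intro sum.cong refl same)
  \<comment> \<open>The sum equals \<open>4 * 2 ^ k - 2\<close>.\<close>
  also have "(\<Sum>i\<in>{1..Suc k}. 2 ^ i) \<le> (4 * 2 ^ k :: real)"
    by (induction k) auto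
  also have "(4 * 2 ^ k :: real) \<le> 4 * d" using k(1) by (simp flip: of_nat_le_iff)
  finally show ?thesis by (simp add: C_def divide_right_mono)
qed

lemma p_coll_bins_star_le:
  assumes lay: "bins_layout m K B" and D: "\<And>d. d \<in> set D \<Longrightarrow> 1 \<le> d \<and> d < 2 ^ num_chunks m"
  shows "p_coll (bins_star m B) D \<le> 4 * pair_load D / 2 ^ num_chunks m"
proof -
  let ?n = "length D" and ?A = "bins_star m B"
  let ?P = "Pi_pmf {..<?n} [] (\<lambda>_. ?A)"
  let ?E = "\<lambda>i j. {\<omega>. set (take (D ! i) (\<omega> i)) \<inter> set (take (D ! j) (\<omega> j)) \<noteq> {}}"
  have pair: "measure_pmf.prob ?P (?E i j) \<le> 4 * real (min (D ! i) (D ! j)) / 2 ^ num_chunks m"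
    if ij: "j < ?n" "i < j" for i j
  proof -
    have Di: "1 \<le> D ! i" "D ! i < 2 ^ num_chunks m" and Dj: "1 \<le> D ! j" "D ! j < 2 ^ num_chunks m"
      using D[of "D ! i"] D[of "D ! j"] ij by auto
    show ?thesis
    proof (cases "D ! i \<le> D ! j")
      case True
      then show ?thesis
        using bins_star_pair_collision[OF lay Di(1) True Dj(2)] ij
        by (subst prob_Pi_pmf_pair[where R = "\<lambda>x y. set (take (D ! i) x) \<inter> set (take (D ! j) y) \<noteq> {}"])
          (auto simp: min_def)
    next
      case False
      \<comment> \<open>The pair bound expects the smaller demand first, so \<open>i\<close> and
        \<open>j\<close> exchange roles.\<close>
      then have "D ! j \<le> D ! i" by simp
      from bins_star_pair_collision[OF lay Dj(1) this Di(2)] False ij show ?thesis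
        by (subst Int_commute,
            subst prob_Pi_pmf_pair[where R = "\<lambda>y x. set (take (D ! j) y) \<inter> set (take (D ! i) x) \<noteq> {}"])
          (auto simp: min_def)
    qed
  qed
  have "{\<omega>. collision D \<omega>} \<subseteq> (\<Union>j<?n. \<Union>i<j. ?E i j)"
  proof
    fix \<omega> assume "\<omega> \<in> {\<omega>. collision D \<omega>}"
    then obtain i j where ij: "i < ?n" "j < ?n" "i \<noteq> j" "\<omega> \<in> ?E i j"
      by (auto simp: collision_def disjoint_family_on_def)
    then have "\<omega> \<in> ?E j i" by auto
    with ij show "\<omega> \<in> (\<Union>j<?n. \<Union>i<j. ?E i j)" by (cases "i < j") (blast, force)
  qed
  then have "p_coll ?A D \<le> measure_pmf.prob ?P (\<Union>j<?n. \<Union>i<j. ?E i j)"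
    unfolding p_coll_def by (intro measure_pmf.finite_measure_mono) auto
  also have "\<dots> \<le> (\<Sum>j<?n. measure_pmf.prob ?P (\<Union>i<j. ?E i j))"
    by (intro measure_UNION_le) auto
  also have "\<dots> \<le> (\<Sum>j<?n. \<Sum>i<j. measure_pmf.prob ?P (?E i j))"
    by (intro sum_mono measure_UNION_le) auto
  also have "\<dots> \<le> (\<Sum>j<?n. \<Sum>i<j. 4 * real (min (D ! i) (D ! j)) / 2 ^ num_chunks m)"
    by (intro sum_mono pair) auto
  also have "\<dots> = 4 * pair_load D / 2 ^ num_chunks m"
    by (simp add: pair_load_def sum_distrib_left sum_divide_distrib)
  finally show ?thesis .
qed

section \<open>Lower bound for every algorithm\<close>

definition output_prob :: "nat list pmf \<Rightarrow> nat \<Rightarrow> nat \<Rightarrow> real" where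
  "output_prob p d x = measure_pmf.prob p {\<omega>. x \<in> set (take d \<omega>)}"

text \<open>For \<open>d \<le> m\<close> the mean of \<open>output_prob p d\<close> over
  \<open>[m]\<close> is \<open>d / m\<close>; the threshold is half of it, so the other IDs carry at
  most half of the total.\<close>

definition heavy :: "nat \<Rightarrow> nat list pmf \<Rightarrow> nat \<Rightarrow> nat set" where
  "heavy m p d = {x \<in> {1..m}. output_prob p d x \<ge> d / (2 * m)}"

context
  fixes m :: nat and p :: "nat list pmf"
  assumes p: "p \<in> id_algs m"
begin

lemma id_algs_support:
  assumes "\<omega> \<in> set_pmf p"
  shows "distinct \<omega>" "set \<omega> = {1..m}" "length \<omega> = m"
proof -
  have "\<omega> \<in> permutations_of_set {1..m}" using p assms by (auto simp: id_algs_def)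
  then show "distinct \<omega>" "set \<omega> = {1..m}" by (auto simp: permutations_of_set_def)
  then show "length \<omega> = m" using distinct_card[of \<omega>] by simp
qed

lemma card_take_id_algs:
  assumes "\<omega> \<in> set_pmf p" "d \<le> m"
  shows "card (set (take d \<omega>)) = d"
  using id_algs_support[OF assms(1)] assms(2) by (simp add: distinct_card)

lemma take_id_algs_subset:
  assumes "\<omega> \<in> set_pmf p"
  shows "set (take d \<omega>) \<subseteq> {1..m}"
  using id_algs_support(2)[OF assms] set_take_subset by metis

lemma finite_set_pmf_id_algs: "finite (set_pmf p)"
  using p finite_subset[of "set_pmf p" "permutations_of_set {1..m}"] by (auto simp: id_algs_def)

lemma integrable_id_algs: "integrable (measure_pmf p) (f :: nat list \<Rightarrow> real)"
  by (rule integrable_measure_pmf_finite[OF finite_set_pmf_id_algs])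

text \<open>Linearity of expectation, the cardinality being a sum of indicators.\<close>

lemma expectation_card_take_Int:
  assumes "finite X"
  shows "measure_pmf.expectation p (\<lambda>\<omega>. real (card (set (take d \<omega>) \<inter> X))) = (\<Sum>x\<in>X. output_prob p d x)"
proof -
  have "real (card (set (take d \<omega>) \<inter> X)) = (\<Sum>x\<in>X. indicator {\<omega>. x \<in> set (take d \<omega>)} \<omega>)" for \<omega>
    using assms by (simp add: indicator_def sum.If_cases Int_def conj_commute)
  then show ?thesis by (simp add: output_prob_def Bochner_Integration.integral_sum integrable_id_algs)
qed

lemma sum_output_prob_heavy:
  assumes "d \<le> m"
  shows "(\<Sum>x\<in>heavy m p d. output_prob p d x) \<ge> d / 2"
proof -
  have "(\<Sum>x\<in>{1..m}. output_prob p d x) =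
      measure_pmf.expectation p (\<lambda>\<omega>. real (card (set (take d \<omega>) \<inter> {1..m})))"
    by (simp add: expectation_card_take_Int)
  also have "\<dots> = measure_pmf.expectation p (\<lambda>\<omega>. real d)"
    using take_id_algs_subset card_take_id_algs assms
    by (intro integral_cong_AE) (auto simp: AE_measure_pmf_iff Int_absorb2)
  finally have total: "(\<Sum>x\<in>{1..m}. output_prob p d x) = d" by simp
  have "(\<Sum>x\<in>{1..m} - heavy m p d. output_prob p d x) \<le> (\<Sum>x\<in>{1..m} - heavy m p d. d / (2 * m))"
    by (intro sum_mono) (auto simp: heavy_def)
  also have "\<dots> \<le> (\<Sum>x\<in>{1..m}. real d / (2 * m))"
    by (intro sum_mono2) auto
  also have "\<dots> \<le> d / 2" by simp
  finally have "(\<Sum>x\<in>{1..m} - heavy m p d. output_prob p d x) \<le> d / 2" .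
  moreover have "(\<Sum>x\<in>{1..m}. output_prob p d x) =
      (\<Sum>x\<in>{1..m} - heavy m p d. output_prob p d x) + (\<Sum>x\<in>heavy m p d. output_prob p d x)"
    by (rule sum.subset_diff) (auto simp: heavy_def)
  ultimately show ?thesis using total by simp
qed

text \<open>The expected number of heavy IDs of \<open>U\<close> among the first \<open>d\<close>
  outputs is at least \<open>card (U \<inter> heavy m p d) * d / (2 * m)\<close>. That number is at
  most \<open>d\<close>, and zero unless \<open>U\<close> is hit; dividing by \<open>d\<close>
  bounds the hitting probability from below.\<close>

lemma prob_take_disjoint_le:
  assumes "1 \<le> d" "d \<le> m"
  shows "measure_pmf.prob p {\<omega>. set (take d \<omega>) \<inter> U = {}} \<le> exp (- real (card (U \<inter> heavy m p d)) / (2 * m))"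
proof -
  let ?X = "U \<inter> heavy m p d"
  let ?hit = "{\<omega>. set (take d \<omega>) \<inter> U \<noteq> {}}"
  have fin: "finite ?X" by (auto simp: heavy_def)
  have "card ?X * (d / (2 * m)) \<le> (\<Sum>x\<in>?X. output_prob p d x)"
    by (intro sum_bounded_below) (auto simp: heavy_def)
  also have "\<dots> = measure_pmf.expectation p (\<lambda>\<omega>. real (card (set (take d \<omega>) \<inter> ?X)))"
    using fin by (simp add: expectation_card_take_Int)
  also have "\<dots> \<le> measure_pmf.expectation p (\<lambda>\<omega>. real d * indicator ?hit \<omega>)"
  proof (intro integral_mono_AE integrable_id_algs, unfold AE_measure_pmf_iff, intro ballI)
    fix \<omega> assume w: "\<omega> \<in> set_pmf p"
    have "card (set (take d \<omega>) \<inter> ?X) \<le> d"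
      using card_mono[of "set (take d \<omega>)" "set (take d \<omega>) \<inter> ?X"] card_take_id_algs[OF w assms(2)] by auto
    moreover have "card (set (take d \<omega>) \<inter> ?X) = 0" if "set (take d \<omega>) \<inter> U = {}"
      using that by (auto simp: card_eq_0_iff)
    ultimately show "real (card (set (take d \<omega>) \<inter> ?X)) \<le> real d * indicator ?hit \<omega>"
      by (auto simp: indicator_def)
  qed
  also have "\<dots> = d * measure_pmf.prob p ?hit" by simp
  finally have "card ?X / (2 * m) \<le> measure_pmf.prob p ?hit"
    using assms by (simp add: field_simps)
  moreover have "measure_pmf.prob p {\<omega>. set (take d \<omega>) \<inter> U = {}} = 1 - measure_pmf.prob p ?hit"
    using measure_pmf.prob_compl[of ?hit p] by (simp add: Compl_eq_Diff_UNIV[symmetric] Collect_neg_eq[symmetric])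
  ultimately show ?thesis
    using exp_ge_add_one_self[of "- real (card ?X) / (2 * m)"] by simp
qed

text \<open>The negated exponent \<open>X\<close> has mean at least
  \<open>(\<Sum>j\<in>I. d j) / (4 * m)\<close>, by the bound on heavy outputs. Replacing
  \<open>exp (- X)\<close> by \<open>1 - X / 2\<close> costs a factor 2, hence the
  \<open>8\<close>.\<close>

lemma expectation_exp_heavy_le:
  fixes I :: "nat set"
  assumes "finite I" "\<And>j. j \<in> I \<Longrightarrow> d j \<le> m" "(\<Sum>j\<in>I. d j) \<le> m"
  shows "measure_pmf.expectation p
      (\<lambda>\<omega>. exp (- (\<Sum>j\<in>I. real (card (set (take (d j) \<omega>) \<inter> heavy m p (d j)))) / (2 * m)))
    \<le> exp (- (\<Sum>j\<in>I. real (d j)) / (8 * m))"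
proof -
  define X where "X = (\<lambda>\<omega>. (\<Sum>j\<in>I. real (card (set (take (d j) \<omega>) \<inter> heavy m p (d j)))) / (2 * m))"
  have fin: "finite (heavy m p e)" for e by (auto simp: heavy_def)
  have "(\<Sum>j\<in>I. real (d j)) / (4 * m) = (\<Sum>j\<in>I. real (d j) / 2) / (2 * m)"
    by (simp flip: sum_divide_distrib)
  also have "\<dots> \<le> (\<Sum>j\<in>I. \<Sum>x\<in>heavy m p (d j). output_prob p (d j) x) / (2 * m)"
    using assms by (intro divide_right_mono sum_mono sum_output_prob_heavy) auto
  also have "\<dots> = measure_pmf.expectation p X"
    by (simp add: X_def Bochner_Integration.integral_sum integrable_id_algs expectation_card_take_Int fin)
  finally have EX: "(\<Sum>j\<in>I. real (d j)) / (4 * m) \<le> measure_pmf.expectation p X" .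
  have "measure_pmf.expectation p (\<lambda>\<omega>. exp (- X \<omega>)) \<le> measure_pmf.expectation p (\<lambda>\<omega>. 1 - X \<omega> / 2)"
  proof (intro integral_mono_AE integrable_id_algs, unfold AE_measure_pmf_iff, intro ballI)
    fix \<omega> assume w: "\<omega> \<in> set_pmf p"
    have "(\<Sum>j\<in>I. card (set (take (d j) \<omega>) \<inter> heavy m p (d j))) \<le> (\<Sum>j\<in>I. d j)"
    proof (intro sum_mono)
      fix j assume "j \<in> I"
      then show "card (set (take (d j) \<omega>) \<inter> heavy m p (d j)) \<le> d j"
        using card_mono[of "set (take (d j) \<omega>)" "set (take (d j) \<omega>) \<inter> heavy m p (d j)"]
          card_take_id_algs[OF w assms(2)] by auto
    qed
    \<comment> \<open>The bound on the total demand keeps \<open>X\<close> in the unit interval, as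
      the linear estimate requires.\<close>
    with assms(3) have "(\<Sum>j\<in>I. card (set (take (d j) \<omega>) \<inter> heavy m p (d j))) \<le> 2 * m" by simp
    then have "(\<Sum>j\<in>I. real (card (set (take (d j) \<omega>) \<inter> heavy m p (d j)))) \<le> 2 * m"
      by (simp flip: of_nat_sum of_nat_le_iff)
    then have "X \<omega> \<le> 1" by (cases "m = 0") (auto simp: X_def divide_le_eq_1)
    moreover have "X \<omega> \<ge> 0" by (simp add: X_def sum_nonneg)
    ultimately show "exp (- X \<omega>) \<le> 1 - X \<omega> / 2" by (intro exp_minus_le_linear)
  qed
  also have "\<dots> = 1 - measure_pmf.expectation p X / 2" by (simp add: integrable_id_algs)
  also have "\<dots> \<le> 1 - (\<Sum>j\<in>I. real (d j)) / (8 * m)" using EX by simp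
  also have "\<dots> \<le> exp (- (\<Sum>j\<in>I. real (d j)) / (8 * m))"
    using exp_ge_add_one_self[of "- (\<Sum>j\<in>I. real (d j)) / (8 * m)"] by simp
  finally show ?thesis by (simp add: X_def)
qed

text \<open>Conditioning on the orderings drawn in \<open>I\<close>, whose outputs may be assumed disjoint, makes
  the events ``\<open>j\<close> avoids the IDs used in \<open>I\<close>'' for \<open>j \<in> J\<close> independent; the resulting bound then
  factorises over \<open>I\<close>. Instance \<open>j\<close> is only compared with the first \<open>D ! j\<close> IDs of those
  \<open>i \<in> I\<close> that have at least as many requests.\<close>

lemma prob_no_collision_le_cut:
  assumes I: "I \<subseteq> {..<length D}" and D: "\<And>d. d \<in> set D \<Longrightarrow> 1 \<le> d \<and> d \<le> m" and sum: "sum_list D \<le> m"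
  defines "J \<equiv> {..<length D} - I"
  shows "measure_pmf.prob (Pi_pmf {..<length D} [] (\<lambda>_. p)) {\<omega>. \<not> collision D \<omega>}
    \<le> exp (- (\<Sum>i\<in>I. \<Sum>j\<in>{j\<in>J. D ! j \<le> D ! i}. real (D ! j)) / (8 * m))"
proof -
  let ?n = "length D"
  let ?M = "Pi_pmf I [] (\<lambda>_. p)" and ?N = "Pi_pmf J [] (\<lambda>_. p)"
  \<comment> \<open>This bounds the conditional probability given the orderings in \<open>I\<close>;
    as a product over \<open>I\<close>, its mean factorises.\<close>
  define g where "g = (\<lambda>f::nat \<Rightarrow> nat list. \<Prod>i\<in>I. exp (- (\<Sum>j\<in>{j\<in>J. D ! j \<le> D ! i}.
    real (card (set (take (D ! j) (f i)) \<inter> heavy m p (D ! j)))) / (2 * m)))"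
  have finI: "finite I" and finJ: "finite J" using I finite_subset by (auto simp: J_def)
  have Dn: "1 \<le> D ! i" "D ! i \<le> m" if "i < ?n" for i using D[of "D ! i"] that by auto
  have "Pi_pmf {..<?n} [] (\<lambda>_. p) = Pi_pmf (I \<union> J) [] (\<lambda>_. p)"
    using I by (simp add: J_def Un_absorb1)
  also have "\<dots> = map_pmf (\<lambda>(f, g) x. if x \<in> I then f x else g x) (pair_pmf ?M ?N)"
    using finI finJ by (intro Pi_pmf_union) (auto simp: J_def)
  finally have "measure_pmf.prob (Pi_pmf {..<?n} [] (\<lambda>_. p)) {\<omega>. \<not> collision D \<omega>} =
      measure_pmf.prob (pair_pmf ?M ?N) {(f, g). \<not> collision D (\<lambda>x. if x \<in> I then f x else g x)}"
    by (simp add: vimage_def case_prod_unfold)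
  also have "\<dots> \<le> measure_pmf.expectation ?M g"
  proof (rule prob_pair_pmf_le)
    show "integrable (measure_pmf ?M) g"
      unfolding g_def by (intro integrable_prod_Pi_pmf finI integrable_id_algs)
    show "g f \<ge> 0" for f by (simp add: g_def prod_nonneg)
    fix f assume f: "f \<in> set_pmf ?M"
    let ?E = "{h. \<not> collision D (\<lambda>x. if x \<in> I then f x else h x)}"
    show "measure_pmf.prob ?N {h. (f, h) \<in> {(f, g). \<not> collision D (\<lambda>x. if x \<in> I then f x else g x)}} \<le> g f"
    proof (cases "disjoint_family_on (\<lambda>i. set (take (D ! i) (f i))) I")
      case False
      \<comment> \<open>A collision inside \<open>I\<close> already rules out the event.\<close>
      then have "?E = {}" using I by (auto simp: collision_def disjoint_family_on_def)
      then show ?thesis by (simp add: g_def prod_nonneg)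
    next
      case True
      define I' where "I' = (\<lambda>j. {i\<in>I. D ! j \<le> D ! i})"
      define U where "U = (\<lambda>j. \<Union>i\<in>I' j. set (take (D ! j) (f i)))"
      \<comment> \<open>Disjointness within \<open>I\<close> turns the union into a sum, which makes
        the exponent additive over \<open>I\<close>.\<close>
      have cardU: "card (U j \<inter> heavy m p (D ! j)) =
          (\<Sum>i\<in>I' j. card (set (take (D ! j) (f i)) \<inter> heavy m p (D ! j)))" for j
      proof -
        have "set (take (D ! j) (f i)) \<subseteq> set (take (D ! i) (f i))" if "i \<in> I' j" for i
          using that by (simp add: I'_def set_take_subset_set_take)
        then have "set (take (D ! j) (f i)) \<inter> set (take (D ! j) (f i')) = {}"
          if "i \<in> I' j" "i' \<in> I' j" "i \<noteq> i'" for i i'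
          using that True unfolding disjoint_family_on_def I'_def by blast
        moreover have "U j \<inter> heavy m p (D ! j) = (\<Union>i\<in>I' j. set (take (D ! j) (f i)) \<inter> heavy m p (D ! j))"
          by (auto simp: U_def)
        ultimately show ?thesis
          using finI by (simp only:, intro card_UN_disjoint) (auto simp: I'_def)
      qed
      have "?E \<subseteq> Pi J (\<lambda>j. {\<omega>. set (take (D ! j) \<omega>) \<inter> U j = {}})"
      proof (intro subsetI Pi_I CollectI)
        fix h j assume h: "h \<in> ?E" and j: "j \<in> J"
        have "set (take (D ! j) (h j)) \<inter> set (take (D ! j) (f i)) = {}" if i: "i \<in> I' j" for i
        proof -
          have "i \<in> I" "i < ?n" "j < ?n" "j \<notin> I" "D ! j \<le> D ! i"
            using i j I by (auto simp: I'_def J_def)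
          moreover have "disjoint_family_on (\<lambda>x. set (take (D ! x) (if x \<in> I then f x else h x))) {..<?n}"
            using h by (simp add: collision_def)
          ultimately have "set (take (D ! j) (h j)) \<inter> set (take (D ! i) (f i)) = {}"
            using disjoint_family_onD[of _ _ j i] by fastforce
          then show ?thesis
            using set_take_subset_set_take[of "D ! j" "D ! i" "f i"] i by (auto simp: I'_def)
        qed
        then show "set (take (D ! j) (h j)) \<inter> U j = {}" by (auto simp: U_def)
      qed
      then have "measure_pmf.prob ?N ?E \<le> measure_pmf.prob ?N (Pi J (\<lambda>j. {\<omega>. set (take (D ! j) \<omega>) \<inter> U j = {}}))"
        by (intro measure_pmf.finite_measure_mono) auto
      also have "\<dots> = (\<Prod>j\<in>J. measure_pmf.prob p {\<omega>. set (take (D ! j) \<omega>) \<inter> U j = {}})"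
        by (rule measure_Pi_pmf_Pi[OF finJ])
      also have "\<dots> \<le> (\<Prod>j\<in>J. exp (- real (card (U j \<inter> heavy m p (D ! j))) / (2 * m)))"
        using Dn by (intro prod_mono conjI prob_take_disjoint_le measure_nonneg) (auto simp: J_def)
      also have "\<dots> = exp (\<Sum>j\<in>J. - real (card (U j \<inter> heavy m p (D ! j))) / (2 * m))"
        by (simp add: exp_sum finJ)
      also have "(\<Sum>j\<in>J. - real (card (U j \<inter> heavy m p (D ! j))) / (2 * m)) =
          (\<Sum>j\<in>J. \<Sum>i\<in>I' j. - (card (set (take (D ! j) (f i)) \<inter> heavy m p (D ! j)) / (2 * m)))"
        by (simp add: cardU sum_divide_distrib sum_negf)
      \<comment> \<open>Exchanging the sums regroups the product over \<open>J\<close> as one over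
        \<open>I\<close>, which is \<open>g\<close>.\<close>
      also have "\<dots> = (\<Sum>i\<in>I. \<Sum>j\<in>{j\<in>J. D ! j \<le> D ! i}.
          - (card (set (take (D ! j) (f i)) \<inter> heavy m p (D ! j)) / (2 * m)))"
        unfolding I'_def by (rule sum.swap_restrict[OF finJ finI])
      also have "exp \<dots> = g f"
        by (simp add: g_def exp_sum[OF finI, symmetric] sum_divide_distrib sum_negf)
      finally show ?thesis by simp
    qed
  qed
  also have "\<dots> = (\<Prod>i\<in>I. measure_pmf.expectation p
      (\<lambda>\<omega>. exp (- (\<Sum>j\<in>{j\<in>J. D ! j \<le> D ! i}.
        real (card (set (take (D ! j) \<omega>) \<inter> heavy m p (D ! j)))) / (2 * m))))"
    unfolding g_def by (intro expectation_prod_Pi_pmf finI integrable_id_algs) auto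
  also have "\<dots> \<le> (\<Prod>i\<in>I. exp (- (\<Sum>j\<in>{j\<in>J. D ! j \<le> D ! i}. real (D ! j)) / (8 * m)))"
  proof (intro prod_mono conjI expectation_exp_heavy_le integral_nonneg_AE)
    fix i
    have "(\<Sum>j\<in>{j\<in>J. D ! j \<le> D ! i}. D ! j) \<le> (\<Sum>j<?n. D ! j)"
      by (intro sum_mono2) (auto simp: J_def)
    also have "\<dots> \<le> m" using sum by (simp add: sum_list_sum_nth atLeast0LessThan)
    finally show "(\<Sum>j\<in>{j\<in>J. D ! j \<le> D ! i}. D ! j) \<le> m" .
  qed (use Dn finJ in \<open>auto simp: J_def\<close>)
  also have "\<dots> = exp (- (\<Sum>i\<in>I. \<Sum>j\<in>{j\<in>J. D ! j \<le> D ! i}. real (D ! j)) / (8 * m))"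
    by (simp add: exp_sum[symmetric] finI sum_divide_distrib sum_negf)
  finally show ?thesis .
qed

text \<open>A cut carries half of \<open>pair_load D\<close>. Each crossing pair is charged to the
  side with the larger demand, so conditioning on one of the two sides captures a quarter; with the
  \<open>8\<close> above this gives \<open>32\<close>.\<close>

lemma prob_no_collision_le_pair_load:
  assumes D: "\<And>d. d \<in> set D \<Longrightarrow> 1 \<le> d \<and> d \<le> m" and sum: "sum_list D \<le> m"
  shows "measure_pmf.prob (Pi_pmf {..<length D} [] (\<lambda>_. p)) {\<omega>. \<not> collision D \<omega>}
    \<le> exp (- pair_load D / (32 * m))"
proof -
  let ?n = "length D" and ?s = "\<lambda>i j. real (min (D ! i) (D ! j))"
  let ?w = "\<lambda>I J. \<Sum>i\<in>I. \<Sum>j\<in>{j\<in>J. D ! j \<le> D ! i}. real (D ! j)"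
  obtain A where A: "A \<subseteq> {..<?n}"
    and cut: "pair_load D \<le> 2 * (\<Sum>i\<in>A. \<Sum>j\<in>{..<?n} - A. ?s i j)"
    using exists_large_cut[of ?s ?n] unfolding pair_load_def by (auto simp: min.commute)
  define B where "B = {..<?n} - A"
  have fin: "finite A" "finite B" using A finite_subset by (auto simp: B_def)
  have AB: "A = {..<?n} - B" "B \<subseteq> {..<?n}" using A by (auto simp: B_def)
  \<comment> \<open>Equal demands are charged to both sides, which only enlarges the right-hand
    side.\<close>
  have "(\<Sum>i\<in>A. \<Sum>j\<in>B. ?s i j) \<le>
      (\<Sum>i\<in>A. \<Sum>j\<in>B. (if D ! j \<le> D ! i then real (D ! j) else 0) + (if D ! i \<le> D ! j then real (D ! i) else 0))"
    by (intro sum_mono) auto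
  also have "\<dots> = ?w A B + (\<Sum>i\<in>A. \<Sum>j\<in>{j\<in>B. D ! i \<le> D ! j}. real (D ! i))"
    using fin by (simp add: sum.distrib sum.inter_filter del: sum_constant)
  also have "(\<Sum>i\<in>A. \<Sum>j\<in>{j\<in>B. D ! i \<le> D ! j}. real (D ! i)) = ?w B A"
    by (rule sum.swap_restrict[OF fin])
  finally have large: "pair_load D / 4 \<le> ?w A B \<or> pair_load D / 4 \<le> ?w B A"
    using cut unfolding B_def[symmetric] by linarith
  have bound: "?thesis" if "I \<subseteq> {..<?n}" "pair_load D / 4 \<le> ?w I ({..<?n} - I)" for I
  proof -
    have "pair_load D / 4 / (8 * m) \<le> ?w I ({..<?n} - I) / (8 * m)"
      using that(2) by (intro divide_right_mono) auto
    then have "exp (- ?w I ({..<?n} - I) / (8 * m)) \<le> exp (- pair_load D / (32 * m))" by simp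
    with prob_no_collision_le_cut[OF that(1) D sum] show ?thesis by linarith
  qed
  from large show ?thesis
  proof
    assume "pair_load D / 4 \<le> ?w A B"
    then show ?thesis using bound[of A] A unfolding B_def by blast
  next
    assume "pair_load D / 4 \<le> ?w B A"
    then show ?thesis using bound[of B] AB(2) unfolding AB(1)[symmetric] by blast
  qed
qed

text \<open>Pigeonhole: more than \<open>m\<close> requests cannot receive distinct IDs from
  \<open>[m]\<close>.\<close>

lemma p_coll_eq_1_if_sum_list_gt:
  assumes "\<And>d. d \<in> set D \<Longrightarrow> d \<le> m" "sum_list D > m"
  shows "p_coll p D = 1"
proof -
  have "collision D \<omega>" if w: "\<omega> \<in> set_pmf (Pi_pmf {..<length D} [] (\<lambda>_. p))" for \<omega>
  proof (rule ccontr)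
    assume "\<not> collision D \<omega>"
    then have disj: "disjoint_family_on (\<lambda>i. set (take (D ! i) (\<omega> i))) {..<length D}"
      by (simp add: collision_def)
    have wi: "\<omega> i \<in> set_pmf p" if "i < length D" for i
      using w that by (auto simp: set_Pi_pmf PiE_dflt_def)
    have "sum_list D = (\<Sum>i<length D. card (set (take (D ! i) (\<omega> i))))"
      using wi assms(1) by (simp add: sum_list_sum_nth atLeast0LessThan card_take_id_algs)
    also have "\<dots> = card (\<Union>i<length D. set (take (D ! i) (\<omega> i)))"
      using disj by (intro card_UN_disjoint[symmetric]) (auto simp: disjoint_family_on_def)
    also have "\<dots> \<le> card {1..m}"
      using wi by (intro card_mono UN_least take_id_algs_subset) auto
    finally show False using assms(2) by simp
  qed
  then show ?thesis
    unfolding p_coll_def by (intro measure_pmf.prob_eq_1[THEN iffD2]) (auto simp: AE_measure_pmf_iff)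
qed

text \<open>Capping at 1 turns the exponential decay into a linear lower bound.\<close>

lemma p_coll_ge:
  assumes D: "\<And>d. d \<in> set D \<Longrightarrow> 1 \<le> d \<and> d \<le> m"
  shows "p_coll p D \<ge> min 1 (pair_load D / (32 * m)) / 2"
proof (cases "sum_list D \<le> m")
  case False
  then have "p_coll p D = 1" using D by (intro p_coll_eq_1_if_sum_list_gt) auto
  then show ?thesis by (simp add: min_def)
next
  case True
  define x where "x = min 1 (pair_load D / (32 * m))"
  have "pair_load D \<ge> 0" by (auto simp: pair_load_def intro!: sum_nonneg)
  then have x: "0 \<le> x" "x \<le> 1" by (auto simp: x_def)
  let ?P = "Pi_pmf {..<length D} [] (\<lambda>_. p)"
  have "1 - p_coll p D = measure_pmf.prob ?P {\<omega>. \<not> collision D \<omega>}"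
    unfolding p_coll_def using measure_pmf.prob_compl[of "{\<omega>. collision D \<omega>}" ?P]
    by (simp add: Compl_eq_Diff_UNIV[symmetric] Collect_neg_eq[symmetric])
  also have "\<dots> \<le> exp (- pair_load D / (32 * m))"
    by (rule prob_no_collision_le_pair_load[OF D True])
  also have "\<dots> \<le> exp (- x)" by (simp add: x_def)
  also have "\<dots> \<le> 1 - x / 2" by (rule exp_minus_le_linear[OF x])
  finally show ?thesis by (simp add: x_def)
qed

end

section \<open>Comparison of the two bounds\<close>

text \<open>The ceiling rounds up log(m / log m). This keeps the admissible demands below
  \<open>2 ^ num_chunks m\<close> and limits the loss in the upper bound to a factor log m.\<close>

lemma power_num_chunks_ge:
  assumes "m \<ge> 2"
  shows "real m / log 2 (real m) \<le> 2 ^ num_chunks m"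
proof -
  define L where "L = log 2 (real m)"
  have L: "L \<ge> 1" unfolding L_def using assms by (simp add: le_log_iff)
  have "real m / L = 2 powr (L - log 2 L)"
    using L assms by (simp add: powr_diff L_def)
  also have "\<dots> \<le> 2 powr (num_chunks m)"
    unfolding num_chunks_def L_def by (intro powr_mono real_nat_ceiling_ge) auto
  also have "\<dots> = 2 ^ num_chunks m" by (simp add: powr_realpow)
  finally show ?thesis by (simp add: L_def)
qed

theorem theorem3p9:
  "\<exists>c::real. \<forall>m::nat. m \<ge> 2 \<longrightarrow>
     (\<forall>K B. bins_layout m K B \<longrightarrow>
        (\<forall>D\<in>profiles_less m (real m / log 2 (real m)).
           p_coll (bins_star m B) D \<le> c * log 2 (real m) * p_star m D))"
proof (intro exI[of _ 256] allI impI ballI)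
  fix m :: nat and K B D
  assume m: "m \<ge> 2" and lay: "bins_layout m K B"
    and D: "D \<in> profiles_less m (real m / log 2 (real m))"
  define L where "L = log 2 (real m)"
  define x where "x = min 1 (pair_load D / (32 * m))"
  have L: "L \<ge> 1" unfolding L_def using m by (simp add: le_log_iff)
  have Dd: "1 \<le> d \<and> d \<le> m \<and> d < 2 ^ num_chunks m" if d: "d \<in> set D" for d
  proof -
    have "d \<le> Max (set D)" using d by simp
    then have "real d < real m / L" using D by (auto simp: profiles_less_def L_def)
    also have "\<dots> \<le> 2 ^ num_chunks m" unfolding L_def by (rule power_num_chunks_ge[OF m])
    finally have "d < 2 ^ num_chunks m" by (simp flip: of_nat_less_iff)
    then show ?thesis using D d by (auto simp: profiles_less_def)
  qed
  have pos: "pair_load D \<ge> 0" by (auto simp: pair_load_def intro!: sum_nonneg)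
  have "p_coll (bins_star m B) D \<le> 4 * pair_load D / 2 ^ num_chunks m"
    using Dd by (intro p_coll_bins_star_le[OF lay]) auto
  also have "\<dots> \<le> 4 * pair_load D / (real m / L)"
    using power_num_chunks_ge[OF m] pos m L by (intro divide_left_mono) (auto simp: L_def)
  \<comment> \<open>Here \<open>128 = 4 * 32\<close>, to match the normalisation of the lower
    bound.\<close>
  also have "\<dots> = 128 * L * (pair_load D / (32 * m))" by simp
  finally have "p_coll (bins_star m B) D \<le> 128 * L * (pair_load D / (32 * m))" .
  moreover have "p_coll (bins_star m B) D \<le> 128 * L"
    using measure_pmf.prob_le_1[of "Pi_pmf {..<length D} [] (\<lambda>_. bins_star m B)" "{\<omega>. collision D \<omega>}"] L
    unfolding p_coll_def by linarith
  \<comment> \<open>The two estimates cover the two cases of the minimum \<open>x\<close>; the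
    halving in the lower bound doubles \<open>128\<close> to \<open>256\<close>.\<close>
  ultimately have "p_coll (bins_star m B) D \<le> 256 * L * (x / 2)"
    by (auto simp: x_def min_def)
  \<comment> \<open>The infimum ranges over a nonempty set, since \<open>bins_star m B\<close>
    belongs to it.\<close>
  also have "x / 2 \<le> p_star m D"
    unfolding p_star_def x_def using bins_star_in_id_algs[OF lay] Dd
    by (intro cINF_greatest p_coll_ge) auto
  finally show "p_coll (bins_star m B) D \<le> 256 * log 2 (real m) * p_star m D"
    using L by (simp add: L_def)
qed

end
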